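(* Let $P\subset\mathbb{R}^d$ be a $d$-polytope, $c$ a generic objective function, $w$ a generic weight, and let $r=P^w$ be the vertex of $P$ maximizing $w$. Let $\mathcal{A}^{\mathrm{MS}}=\mathcal{A}^{\mathrm{MS}}_{P,c}(w)$ be the max-slope arborescence of $(P,c)$ with respect to $w$. The path $(r_i)_{i\geq0}$ in $V(P)$ with $r_0:=r$ and $r_{i+1}:=\mathcal{A}^{\mathrm{MS}}(r_i)$ for $i\geq0$ (which becomes constant once it reaches the optimal vertex $v_{opt}$) is precisely the shadow-vertex path of $(P,c)$ with respect to $w$.
   Context: $c\in\mathbb{R}^d$ is generic for $P$ if $c^tu\neq c^tv$ for all edges $uv$; $v_{opt}$ is then the unique vertex maximizing $c$, and $\mathrm{Nb}_{P,c}(v)$ is the set of vertices $u$ adjacent to $v$ with $c^tu>c^tv$. A weight $w\in\mathbb{R}^d$ is generic if it is linearly independent of $c$, it is maximized over $P$ at a unique vertex $P^w$, and for every vertex $v\ne v_{opt}$ the maximum of $\frac{w^t(u-v)}{c^t(u-v)}$ over $u\in\mathrm{Nb}_{P,c}(v)$ is attained uniquely. The max-slope arborescence $\mathcal{A}^{\mathrm{MS}}_{P,c}(w):V(P)\to V(P)$ fixes $v_{opt}$ and maps each $v\neq v_{opt}$ to this unique maximizer. Shadow-vertex path: let $\pi:\mathbb{R}^d\to\mathbb{R}^2$, $\pi(x)=(c^tx,w^tx)$. Then $\pi(r)$ and $\pi(v_{opt})$ are vertices of the polygon $\pi(P)$ (the points maximizing the second, respectively first, coordinate). Consider the path along the upper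 boundary of $\pi(P)$ (upper with respect to the second coordinate) from $\pi(r)$ to $\pi(v_{opt})$, along which the first coordinate increases. For generic $w$ its preimage in $P$ under $\pi$ is a $c$-increasing vertex-edge path from $r$ to $v_{opt}$; this is the shadow-vertex path of $(P,c)$ with respect to $w$. *)

theory Defs
  imports "HOL-Analysis.Analysis"
begin

definition adjacent_vertices :: "(real^'n) set \<Rightarrow> real^'n \<Rightarrow> real^'n \<Rightarrow> bool" where
  "adjacent_vertices P u v \<longleftrightarrow>
     u extreme_point_of P \<and> v extreme_point_of P \<and> closed_segment u v edge_of P"

definition generic_objective :: "(real^'n) set \<Rightarrow> real^'n \<Rightarrow> bool" where
  "generic_objective P c \<longleftrightarrow> (\<forall>u v. adjacent_vertices P u v \<longrightarrow> c \<bullet> u \<noteq> c \<bullet> v)"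

definition maximizing_vertex :: "(real^'n) set \<Rightarrow> real^'n \<Rightarrow> real^'n \<Rightarrow> bool" where
  "maximizing_vertex P a v \<longleftrightarrow>
     v extreme_point_of P \<and> is_arg_max (\<lambda>x. a \<bullet> x) (\<lambda>x. x \<in> P) v"

(* This is both v_opt (for a = c) and P^w (for a = w). The description is meaningful only
   when the maximizing vertex is unique, which holds for a generic objective on a polytope
   and is part of the definition of a generic weight. *)
definition opt_vertex :: "(real^'n) set \<Rightarrow> real^'n \<Rightarrow> real^'n" where
  "opt_vertex P a = (THE v. maximizing_vertex P a v)"

definition improving_nbs :: "(real^'n) set \<Rightarrow> real^'n \<Rightarrow> real^'n \<Rightarrow> (real^'n) set" where
  "improving_nbs P c v = {u. adjacent_vertices P v u \<and> c \<bullet> u > c \<bullet> v}"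

definition max_slope_nb ::
    "(real^'n) set \<Rightarrow> real^'n \<Rightarrow> real^'n \<Rightarrow> real^'n \<Rightarrow> real^'n \<Rightarrow> bool" where
  "max_slope_nb P c w v u \<longleftrightarrow>
     is_arg_max (\<lambda>u. (w \<bullet> (u - v)) / (c \<bullet> (u - v))) (\<lambda>u. u \<in> improving_nbs P c v) u"

(* The conjunct c \<noteq> w is needed because for c = w the set {c, w} collapses to a singleton. *)
definition generic_weight :: "(real^'n) set \<Rightarrow> real^'n \<Rightarrow> real^'n \<Rightarrow> bool" where
  "generic_weight P c w \<longleftrightarrow>
     c \<noteq> w \<and> independent {c, w} \<and>
     (\<exists>!v. maximizing_vertex P w v) \<and>
     (\<forall>v. v extreme_point_of P \<and> v \<noteq> opt_vertex P c \<longrightarrow> (\<exists>!u. max_slope_nb P c w v u))"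

(* Only the values at vertices of P are meaningful. *)
definition max_slope_arborescence ::
    "(real^'n) set \<Rightarrow> real^'n \<Rightarrow> real^'n \<Rightarrow> real^'n \<Rightarrow> real^'n" where
  "max_slope_arborescence P c w v =
     (if v = opt_vertex P c then v else (THE u. max_slope_nb P c w v u))"

definition plane_proj :: "real^'n \<Rightarrow> real^'n \<Rightarrow> real^'n \<Rightarrow> real \<times> real" where
  "plane_proj c w x = (c \<bullet> x, w \<bullet> x)"

definition upper_boundary :: "(real \<times> real) set \<Rightarrow> (real \<times> real) set" where
  "upper_boundary Q = {p \<in> Q. \<forall>q\<in>Q. fst q = fst p \<longrightarrow> snd q \<le> snd p}"

(* The part of the upper boundary of the projected polytope between the images of P^w and
   v_opt, as a point set. *)
definition upper_path :: "(real^'n) set \<Rightarrow> real^'n \<Rightarrow> real^'n \<Rightarrow> (real \<times> real) set" where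
  "upper_path P c w =
     {p \<in> upper_boundary (plane_proj c w ` P).
        fst (plane_proj c w (opt_vertex P w)) \<le> fst p \<and>
        fst p \<le> fst (plane_proj c w (opt_vertex P c))}"

(* A vertex-edge path is given by its list of successive vertices. *)
definition increasing_path ::
    "(real^'n) set \<Rightarrow> real^'n \<Rightarrow> real^'n \<Rightarrow> real^'n \<Rightarrow> (real^'n) list \<Rightarrow> bool" where
  "increasing_path P c u v xs \<longleftrightarrow>
     xs \<noteq> [] \<and> hd xs = u \<and> last xs = v \<and> (\<forall>x\<in>set xs. x extreme_point_of P) \<and>
     successively (\<lambda>x y. adjacent_vertices P x y \<and> c \<bullet> x < c \<bullet> y) xs"

(* The vertices are included separately to cover paths consisting of a single vertex. *)
definition path_points :: "(real^'n) list \<Rightarrow> (real^'n) set" where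
  "path_points xs = set xs \<union> (\<Union>i<length xs - 1. closed_segment (xs ! i) (xs ! Suc i))"

definition shadow_vertex_path ::
    "(real^'n) set \<Rightarrow> real^'n \<Rightarrow> real^'n \<Rightarrow> (real^'n) list \<Rightarrow> bool" where
  "shadow_vertex_path P c w xs \<longleftrightarrow>
     increasing_path P c (opt_vertex P w) (opt_vertex P c) xs \<and>
     path_points xs = {x \<in> P. plane_proj c w x \<in> upper_path P c w}"

end

theory Submission imports Defs
begin

text \<open>Along the path every vertex maximizes, up to ties to its left, some functional
  \<open>w - t c\<close>; at \<open>r\<close> one takes \<open>t = 0\<close>. If \<open>s\<close> is the maximal slope at such a vertex \<open>v\<close>, then
  \<open>s < t\<close>, so no neighbour of \<open>v\<close>, improving or not, beats \<open>v\<close> for \<open>w - s c\<close>, and the unique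
  maximizer \<open>u\<close> of the slope is the only one that ties with \<open>v\<close>. Since local optima of linear
  functionals on polytopes are global, the face where \<open>w - s c\<close> is maximal is exactly the edge
  \<open>[v, u]\<close>: it is the full preimage of an edge of the upper boundary of the shadow, and \<open>u\<close>
  inherits the property with \<open>s\<close> in place of \<open>t\<close>.\<close>

section \<open>Extreme points, faces and hyperplane slices of polytopes\<close>

text \<open>By Krein-Milman, \<open>S\<close> is the hull of its extreme points, so a closed
  halfspace containing all of them would contain \<open>x\<close> as well.\<close>

lemma compact_convex_extreme_point_greater:
  fixes S :: "'a::euclidean_space set"
  assumes "compact S" "convex S" "x \<in> S" "k < a \<bullet> x"
  obtains e where "e extreme_point_of S" "k < a \<bullet> e"
proof -
  have "\<not> {e. e extreme_point_of S} \<subseteq> {y. a \<bullet> y \<le> k}"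
  proof
    assume "{e. e extreme_point_of S} \<subseteq> {y. a \<bullet> y \<le> k}"
    then have "convex hull {e. e extreme_point_of S} \<subseteq> {y. a \<bullet> y \<le> k}"
      by (rule hull_minimal) (rule convex_halfspace_le)
    then show False
      using assms Krein_Milman_Minkowski[of S] by auto
  qed
  then show thesis
    using that by (metis mem_Collect_eq not_le subsetI)
qed

text \<open>Take a minimal face containing \<open>y\<close>, which exists because there are finitely
  many faces. On its relative frontier \<open>y\<close> would lie in a smaller face.\<close>

lemma polytope_face_rel_interior:
  fixes P :: "'a::euclidean_space set"
  assumes "polytope P" "y \<in> P"
  obtains F where "F face_of P" "y \<in> rel_interior F"
proof -
  let ?\<F> = "{F. F face_of P \<and> y \<in> F}"
  have "finite ?\<F>"
    using finite_polytope_faces[OF assms(1)] by (rule rev_finite_subset) auto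
  moreover have "P \<in> ?\<F>"
    using assms by (simp add: face_of_refl polytope_imp_convex)
  ultimately obtain F where F: "F \<in> ?\<F>" and min: "\<And>G. G \<in> ?\<F> \<Longrightarrow> G \<subseteq> F \<Longrightarrow> F = G"
    using finite_has_minimal[of ?\<F>] by blast
  have pF: "polytope F"
    using F assms(1) face_of_polytope_polytope by blast
  have "y \<notin> rel_frontier F"
  proof
    assume "y \<in> rel_frontier F"
    then obtain G where "G face_of F" "G \<noteq> F" "y \<in> G"
      using rel_frontier_of_polyhedron_alt[OF polytope_imp_polyhedron[OF pF]] by auto
    then show False
      using min[of G] F face_of_trans face_of_imp_subset by blast
  qed
  then have "y \<in> rel_interior F"
    using F closure_subset[of F] by (auto simp: rel_frontier_def)
  with F that show thesis by auto
qed

text \<open>The face with \<open>y\<close> in its relative interior has dimension at most 1: the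
  hyperplane would cut the affine hull of a larger face in at least a line through \<open>y\<close>,
  and \<open>y\<close> could move both ways along it inside the slice.\<close>

lemma extreme_point_of_hyperplane_slice:
  fixes P :: "'a::euclidean_space set"
  assumes P: "polytope P" and y: "y extreme_point_of (P \<inter> {x. h \<bullet> x = k})"
  shows "y extreme_point_of P \<or> (\<exists>p q. closed_segment p q edge_of P \<and> y \<in> closed_segment p q)"
proof -
  let ?H = "{x. h \<bullet> x = k}"
  have yP: "y \<in> P" and yH: "h \<bullet> y = k"
    using y by (auto simp: extreme_point_of_def)
  obtain F where F: "F face_of P" and yF: "y \<in> rel_interior F"
    using polytope_face_rel_interior[OF P yP] by blast
  have pF: "polytope F" using P F face_of_polytope_polytope by blast
  have y_F: "y \<in> F" using yF rel_interior_subset by blast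
  have "aff_dim F \<le> 1"
  proof (rule ccontr)
    assume "\<not> aff_dim F \<le> 1"
    moreover have "affine hull F \<inter> ?H \<noteq> {}"
      using y_F yH hull_inc[of y F affine] by auto
    ultimately have "1 \<le> aff_dim (affine hull F \<inter> ?H)"
      by (simp add: aff_dim_affine_Int_hyperplane)
    then have "affine hull F \<inter> ?H \<noteq> {y}"
      by (metis aff_dim_sing not_one_le_zero)
    then obtain x where x: "x \<in> affine hull F" "h \<bullet> x = k" "x \<noteq> y"
      using y_F yH hull_inc[of y F affine] by blast
    obtain e where e: "e > 0" "cball y e \<inter> affine hull F \<subseteq> F"
      using yF unfolding rel_interior_cball by auto
    \<comment> \<open>Scaled so that both \<open>y + d *\<^sub>R (x - y)\<close> and its reflection
      in \<open>y\<close> have distance \<open>e\<close> from \<open>y\<close>, hence stay in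
      \<open>F\<close>.\<close>
    define d where "d = e / norm (x - y)"
    have d: "d > 0" "norm (d *\<^sub>R (x - y)) = e"
      using e x by (auto simp: d_def)
    have mem: "y + s *\<^sub>R (x - y) \<in> affine hull F" for s
    proof -
      have "(1 - s) *\<^sub>R y + s *\<^sub>R x \<in> affine hull F"
        using x y_F hull_inc[of y F affine] affine_affine_hull[of F]
        unfolding affine_alt by blast
      then show ?thesis by (simp add: algebra_simps)
    qed
    have "y + s *\<^sub>R (x - y) \<in> P \<inter> ?H" if "\<bar>s\<bar> = d" for s
    proof -
      have "norm (s *\<^sub>R (x - y)) = e" using d that by simp
      then have "y + s *\<^sub>R (x - y) \<in> cball y e"
        by (simp add: dist_norm)
      then have "y + s *\<^sub>R (x - y) \<in> F" using mem e by blast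
      then show ?thesis
        using F face_of_imp_subset x(2) yH by (auto simp: inner_simps)
    qed
    from this[of d] this[of "- d"] d(1)
    have *: "y + d *\<^sub>R (x - y) \<in> P \<inter> ?H" "y - d *\<^sub>R (x - y) \<in> P \<inter> ?H" by auto
    have "midpoint (y - d *\<^sub>R (x - y)) (y + d *\<^sub>R (x - y)) = y"
      by (simp add: midpoint_def algebra_simps flip: scaleR_2)
    moreover have "y - d *\<^sub>R (x - y) \<noteq> y + d *\<^sub>R (x - y)"
    proof
      assume "y - d *\<^sub>R (x - y) = y + d *\<^sub>R (x - y)"
      moreover have "2 *\<^sub>R (d *\<^sub>R (x - y)) = (y + d *\<^sub>R (x - y)) - (y - d *\<^sub>R (x - y))"
        by (simp only: scaleR_2) simp
      ultimately have "2 *\<^sub>R (d *\<^sub>R (x - y)) = 0" by simp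
      then show False using d x by simp
    qed
    ultimately have "y \<in> open_segment (y - d *\<^sub>R (x - y)) (y + d *\<^sub>R (x - y))"
      by (metis midpoint_in_open_segment)
    with * y show False unfolding extreme_point_of_def by blast
  qed
  show ?thesis
  proof (cases "aff_dim F = 1")
    case True
    then obtain p q where "F = closed_segment p q"
      using compact_convex_collinear_segment[of F] y_F pF
      by (metis collinear_aff_dim empty_iff order_refl polytope_imp_compact polytope_imp_convex)
    with True F y_F show ?thesis by (auto simp: edge_of_def)
  next
    case False
    have "0 \<le> aff_dim F" using y_F by (metis aff_dim_negative_iff empty_iff not_le)
    with False \<open>aff_dim F \<le> 1\<close> have "aff_dim F = 0" by linarith
    then have "F = {y}" using y_F by (auto simp: aff_dim_eq_0)
    with F show ?thesis by (simp add: face_of_singleton)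
  qed
qed

section \<open>Edges at a vertex and local optimality\<close>

lemma segment_edge_adjacent:
  assumes "closed_segment u v edge_of P"
  shows "adjacent_vertices P u v"
proof -
  have "closed_segment u v face_of P" using assms by (simp add: edge_of_def)
  then have "u extreme_point_of P" "v extreme_point_of P"
    using extreme_point_of_face[of "closed_segment u v" P] extreme_point_of_segment by blast+
  with assms show ?thesis by (simp add: adjacent_vertices_def)
qed

text \<open>The local optimality criterion of the simplex method, proved on the vertex figure:
  cut off \<open>v\<close> by a hyperplane and maximize over the slice, whose extreme points lie on edges
  at \<open>v\<close>.\<close>

lemma improving_neighbour_exists:
  fixes P :: "(real^'n) set"
  assumes P: "polytope P" and v: "v extreme_point_of P" and z: "z \<in> P" "a \<bullet> v < a \<bullet> z"
  obtains u where "adjacent_vertices P v u" "a \<bullet> v < a \<bullet> u"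
proof -
  note cP = polytope_imp_compact[OF P] polytope_imp_convex[OF P]
  \<comment> \<open>Faces of polyhedra are exposed, which supplies a hyperplane touching
    \<open>P\<close> only at \<open>v\<close>.\<close>
  have "{v} exposed_face_of P"
    using v by (simp add: exposed_face_of_polyhedron[OF polytope_imp_polyhedron[OF P]] face_of_singleton)
  then obtain h b where hb: "P \<subseteq> {x. h \<bullet> x \<le> b}" "{v} = P \<inter> {x. h \<bullet> x = b}"
    unfolding exposed_face_of_def by blast
  have hv: "h \<bullet> v = b" and hP: "\<And>x. x \<in> P \<Longrightarrow> x \<noteq> v \<Longrightarrow> h \<bullet> x < b"
    using hb by (force simp: less_le)+
  obtain z' where z': "z' extreme_point_of P" "a \<bullet> v < a \<bullet> z'"
    using compact_convex_extreme_point_greater[OF cP z] by blast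
  define V where "V = {x. x extreme_point_of P} - {v}"
  have finV: "finite V" unfolding V_def
    using finite_polyhedron_extreme_points[OF polytope_imp_polyhedron[OF P]] by blast
  have z'V: "z' \<in> V" using z' by (auto simp: V_def)
  have "Max ((\<bullet>) h ` V) < b"
    using finV z'V hP by (subst Max_less_iff) (auto simp: V_def extreme_point_of_def)
  \<comment> \<open>Level \<open>k\<close> strictly separates \<open>v\<close> from all other
    vertices, so no vertex of \<open>P\<close> lies on the slice.\<close>
  then obtain k where k: "Max ((\<bullet>) h ` V) < k" "k < b" using dense by blast
  then have kV: "h \<bullet> x < k" if "x \<in> V" for x
    using finV that by (subst (asm) Max_less_iff) auto
  let ?Q = "P \<inter> {x. h \<bullet> x = k}"
  \<comment> \<open>The segment from a better vertex to \<open>v\<close> meets the slice at a point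
    other than \<open>v\<close>, so that point still beats \<open>v\<close>, and then so does some
    extreme point of the slice.\<close>
  have "\<exists>y \<in> closed_segment z' v. h \<bullet> y = k"
  proof (rule connected_ivt_hyperplane)
    show "connected (closed_segment z' v)" by simp
    show "z' \<in> closed_segment z' v" "v \<in> closed_segment z' v" by auto
    show "h \<bullet> z' \<le> k" "k \<le> h \<bullet> v" using kV[OF z'V] k hv by auto
  qed
  then obtain y where y: "y \<in> closed_segment z' v" "h \<bullet> y = k" by blast
  have yP: "y \<in> P"
    using y z' v cP closed_segment_subset[of z' P v] by (auto simp: extreme_point_of_def)
  have "a \<bullet> v < a \<bullet> y"
  proof -
    obtain s where s: "y = (1 - s) *\<^sub>R z' + s *\<^sub>R v" "0 \<le> s" "s \<le> 1"
      using y by (auto simp: closed_segment_def)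
    have "s \<noteq> 1" using s y k hv by auto
    then have "0 < (1 - s) * (a \<bullet> z' - a \<bullet> v)" using s z' by simp
    then show ?thesis unfolding s(1) by (simp add: inner_simps algebra_simps)
  qed
  moreover have "compact ?Q" "convex ?Q"
    using cP by (auto intro: compact_Int_closed closed_hyperplane convex_Int convex_hyperplane)
  ultimately obtain e where e: "e extreme_point_of ?Q" "a \<bullet> v < a \<bullet> e"
    using compact_convex_extreme_point_greater[of ?Q y "a \<bullet> v" a] yP y by auto
  have he: "h \<bullet> e = k" using e by (auto simp: extreme_point_of_def)
  have "\<not> e extreme_point_of P"
    using kV[of e] he hv k by (auto simp: V_def)
  then obtain p q where pq: "closed_segment p q edge_of P" "e \<in> closed_segment p q"
    using extreme_point_of_hyperplane_slice[OF P e(1)] by blast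
  \<comment> \<open>An edge avoiding \<open>v\<close> has both ends in \<open>V\<close> and so lies
    strictly below level \<open>k\<close>, missing \<open>e\<close>.\<close>
  have "p = v \<or> q = v"
  proof (rule ccontr)
    assume "\<not> (p = v \<or> q = v)"
    then have "p \<in> V" "q \<in> V"
      using segment_edge_adjacent[OF pq(1)] by (auto simp: V_def adjacent_vertices_def)
    then have "closed_segment p q \<subseteq> {x. h \<bullet> x < k}"
      using kV by (intro closed_segment_subset) (auto simp: convex_halfspace_lt)
    with pq he show False by auto
  qed
  then obtain u where u: "closed_segment v u edge_of P" "e \<in> closed_segment v u"
    using pq by (metis closed_segment_commute)
  have "a \<bullet> v < a \<bullet> u"
  proof (rule ccontr)
    assume "\<not> a \<bullet> v < a \<bullet> u"
    then have "closed_segment v u \<subseteq> {x. a \<bullet> x \<le> a \<bullet> v}"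
      by (intro closed_segment_subset) (auto simp: convex_halfspace_le)
    with u e show False by auto
  qed
  with u segment_edge_adjacent that show thesis by blast
qed


lemma adjacent_vertices_face:
  assumes "F face_of P" "adjacent_vertices F u v"
  shows "adjacent_vertices P u v" "v \<in> F"
proof -
  show "adjacent_vertices P u v"
    using assms face_of_trans[OF _ assms(1)]
    by (simp add: adjacent_vertices_def edge_of_def extreme_point_of_face[OF assms(1)])
  show "v \<in> F"
    using assms(2) by (simp add: adjacent_vertices_def extreme_point_of_def)
qed

section \<open>Existence and uniqueness of maximizing vertices\<close>

lemma maximizing_vertex_exists:
  fixes P :: "(real^'n) set"
  assumes P: "polytope P" and "P \<noteq> {}"
  obtains v where "maximizing_vertex P a v"
proof -
  obtain x where x: "x \<in> P" "\<And>y. y \<in> P \<Longrightarrow> a \<bullet> y \<le> a \<bullet> x"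
    using continuous_attains_sup[OF polytope_imp_compact[OF P] assms(2), of "(\<bullet>) a"]
      continuous_on_inner[OF continuous_on_const continuous_on_id] by blast
  let ?F = "P \<inter> {y. a \<bullet> y = a \<bullet> x}"
  have F: "?F face_of P"
    using x P polytope_imp_convex by (intro face_of_Int_supporting_hyperplane_le) auto
  have "compact ?F"
    using P F face_of_polytope_polytope polytope_imp_compact by blast
  moreover have "?F \<noteq> {}" using x by blast
  ultimately obtain v where "v extreme_point_of ?F"
    using extreme_point_exists_convex face_of_imp_convex[OF F] by blast
  then have "v extreme_point_of P" "a \<bullet> v = a \<bullet> x" "v \<in> P"
    using extreme_point_of_face[OF F] by auto
  with x have "maximizing_vertex P a v"
    by (simp add: maximizing_vertex_def is_arg_max_def not_less)
  with that show thesis .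
qed

text \<open>Uniqueness among vertices extends to uniqueness among all points. If \<open>x\<close>
  tied with \<open>v\<close>, the functional \<open>x - v\<close> would single out an extreme point
  of the maximal face different from \<open>v\<close>.\<close>

lemma maximizing_vertex_strict:
  fixes P :: "(real^'n) set"
  assumes P: "polytope P" and v: "maximizing_vertex P a v"
    and unique: "\<And>v'. maximizing_vertex P a v' \<Longrightarrow> v' = v"
    and x: "x \<in> P" "x \<noteq> v"
  shows "a \<bullet> x < a \<bullet> v"
proof (rule ccontr)
  assume "\<not> a \<bullet> x < a \<bullet> v"
  moreover have max: "\<And>y. y \<in> P \<Longrightarrow> a \<bullet> y \<le> a \<bullet> v"
    using v by (simp add: maximizing_vertex_def is_arg_max_def not_less)
  ultimately have ax: "a \<bullet> x = a \<bullet> v" using x by (meson antisym not_le)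
  let ?F = "P \<inter> {y. a \<bullet> y = a \<bullet> v}"
  have F: "?F face_of P"
    using max P polytope_imp_convex by (intro face_of_Int_supporting_hyperplane_le) auto
  have pF: "polytope ?F" using P F face_of_polytope_polytope by blast
  have "0 < (x - v) \<bullet> (x - v)" using x by simp
  then have "(x - v) \<bullet> v < (x - v) \<bullet> x" by (simp only: inner_diff_right)
  then obtain e where e: "e extreme_point_of ?F" "(x - v) \<bullet> v < (x - v) \<bullet> e"
    using compact_convex_extreme_point_greater[of ?F x] pF polytope_imp_compact polytope_imp_convex
      x ax by blast
  then have "e extreme_point_of P" "a \<bullet> e = a \<bullet> v"
    using extreme_point_of_face[OF F] by auto
  then have "maximizing_vertex P a e"
    using max by (simp add: maximizing_vertex_def is_arg_max_def extreme_point_of_def not_less)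
  with unique e show False by blast
qed

text \<open>Two maximizers would span a maximal face with an edge at \<open>v\<close>. On this edge
  \<open>c\<close> is constant, contrary to genericity.\<close>

lemma generic_objective_maximizing_vertex_unique:
  fixes P :: "(real^'n) set"
  assumes P: "polytope P" and gen: "generic_objective P c"
    and v: "maximizing_vertex P c v" and v': "maximizing_vertex P c v'"
  shows "v' = v"
proof (rule ccontr)
  assume neq: "v' \<noteq> v"
  have max: "\<And>y. y \<in> P \<Longrightarrow> c \<bullet> y \<le> c \<bullet> v" and max': "c \<bullet> v \<le> c \<bullet> v'"
    and vP: "v \<in> P" "v' \<in> P"
    using v v' by (simp_all add: maximizing_vertex_def is_arg_max_def not_less)
  have eq: "c \<bullet> v' = c \<bullet> v" using max[OF vP(2)] max' by simp
  let ?F = "P \<inter> {y. c \<bullet> y = c \<bullet> v}"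
  have F: "?F face_of P"
    using max P polytope_imp_convex by (intro face_of_Int_supporting_hyperplane_le) auto
  have "0 < (v' - v) \<bullet> (v' - v)" using neq by simp
  then have "(v' - v) \<bullet> v < (v' - v) \<bullet> v'" by (simp only: inner_diff_right)
  moreover have "v extreme_point_of ?F"
    using v vP extreme_point_of_face[OF F] by (auto simp: maximizing_vertex_def)
  ultimately obtain u where "adjacent_vertices ?F v u"
    using improving_neighbour_exists[of ?F v v'] face_of_polytope_polytope[OF P F] vP eq by blast
  from adjacent_vertices_face[OF F this] gen show False
    by (force simp: generic_objective_def)
qed

lemma opt_vertexI:
  assumes "maximizing_vertex P a v" "\<And>v'. maximizing_vertex P a v' \<Longrightarrow> v' = v"
  shows "opt_vertex P a = v"
  unfolding opt_vertex_def using assms by (rule the_equality)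

section \<open>One max-slope step as an edge of the upper boundary\<close>

text \<open>The image of \<open>v\<close> is the right end of the piece of the shadow on which a line of slope \<open>t\<close>
  supports it from above.\<close>

definition upper_vertex :: "(real^'n) set \<Rightarrow> real^'n \<Rightarrow> real^'n \<Rightarrow> real \<Rightarrow> real^'n \<Rightarrow> bool" where
  "upper_vertex P c w t v \<longleftrightarrow> v extreme_point_of P \<and>
     (\<forall>x\<in>P. (w - t *\<^sub>R c) \<bullet> x \<le> (w - t *\<^sub>R c) \<bullet> v \<and>
            ((w - t *\<^sub>R c) \<bullet> x = (w - t *\<^sub>R c) \<bullet> v \<longrightarrow> x = v \<or> c \<bullet> x < c \<bullet> v))"

text \<open>The induction step of the walk: the supporting line rotates about the image of
  \<open>v\<close> from slope \<open>t\<close> down to slope \<open>s\<close>, until it contains the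
  image of the edge to \<open>u\<close>.\<close>

lemma max_slope_edge:
  fixes P :: "(real^'n) set"
  assumes P: "polytope P" and gen: "generic_objective P c"
    and up: "upper_vertex P c w t v"
    and u: "max_slope_nb P c w v u" and unique: "\<And>u'. max_slope_nb P c w v u' \<Longrightarrow> u' = u"
  defines "s \<equiv> w \<bullet> (u - v) / (c \<bullet> (u - v))"
  shows "\<And>x. x \<in> P \<Longrightarrow> (w - s *\<^sub>R c) \<bullet> x \<le> (w - s *\<^sub>R c) \<bullet> v"
    and "P \<inter> {x. (w - s *\<^sub>R c) \<bullet> x = (w - s *\<^sub>R c) \<bullet> v} = closed_segment v u"
    and "upper_vertex P c w s u"
proof -
  let ?g = "w - s *\<^sub>R c"
  have adj: "adjacent_vertices P v u" and cu: "c \<bullet> v < c \<bullet> u"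
    and slope: "\<And>u'. adjacent_vertices P v u' \<Longrightarrow> c \<bullet> v < c \<bullet> u' \<Longrightarrow>
                  w \<bullet> (u' - v) / (c \<bullet> (u' - v)) \<le> s"
    using u by (force simp: max_slope_nb_def is_arg_max_def improving_nbs_def s_def)+
  have uP: "u extreme_point_of P" "u \<in> P" and vP: "v extreme_point_of P" "v \<in> P"
    using adj by (auto simp: adjacent_vertices_def extreme_point_of_def)
  have tmax: "w \<bullet> x - t * (c \<bullet> x) \<le> w \<bullet> v - t * (c \<bullet> v)" if "x \<in> P" for x
    using up that by (auto simp: upper_vertex_def inner_diff_left)
  \<comment> \<open>A tie is allowed only to the left of \<open>v\<close>, and \<open>u\<close> lies
    to its right. The inequality is therefore strict, which yields \<open>s < t\<close>.\<close>
  have "(w - t *\<^sub>R c) \<bullet> u \<noteq> (w - t *\<^sub>R c) \<bullet> v"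
    using up uP cu by (force simp: upper_vertex_def)
  with tmax[OF uP(2)] have "w \<bullet> (u - v) < t * (c \<bullet> (u - v))"
    by (simp add: inner_simps algebra_simps)
  then have st: "s < t"
    using cu by (simp add: s_def divide_less_eq inner_diff_right)
  have gu: "?g \<bullet> u = ?g \<bullet> v"
    using cu by (simp add: s_def inner_simps field_simps)
  have nb: "?g \<bullet> u' \<le> ?g \<bullet> v \<and> (?g \<bullet> u' = ?g \<bullet> v \<longrightarrow> u' = u)"
    if u': "adjacent_vertices P v u'" for u'
  proof (cases "c \<bullet> v < c \<bullet> u'")
    case True
    have le: "w \<bullet> (u' - v) \<le> s * (c \<bullet> (u' - v))"
      using slope[OF u' True] True by (simp add: divide_le_eq inner_diff_right)
    have "u' = u" if "?g \<bullet> u' = ?g \<bullet> v"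
    proof (rule unique)
      have "w \<bullet> (u' - v) = s * (c \<bullet> (u' - v))"
        using that by (simp add: inner_simps algebra_simps)
      then have "w \<bullet> (u' - v) / (c \<bullet> (u' - v)) = s"
        using True by (simp add: inner_diff_right)
      then show "max_slope_nb P c w v u'"
        using u u' True by (simp add: max_slope_nb_def is_arg_max_def improving_nbs_def s_def)
    qed
    with le show ?thesis by (simp add: inner_simps algebra_simps)
  next
    case False
    with gen u' have "c \<bullet> u' < c \<bullet> v" by (force simp: generic_objective_def)
    \<comment> \<open>Since \<open>w - s c = (w - t c) + (t - s) c\<close>, a neighbour with smaller
      \<open>c\<close> does not gain in the first summand and loses strictly in the second.\<close>
    then have "(t - s) * (c \<bullet> u') < (t - s) * (c \<bullet> v)" using st by simp
    moreover have "u' \<in> P" using u' by (auto simp: adjacent_vertices_def extreme_point_of_def)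
    ultimately have "?g \<bullet> u' < ?g \<bullet> v"
      using tmax[of u'] by (simp add: inner_simps algebra_simps)
    then show ?thesis by simp
  qed
  show max: "?g \<bullet> x \<le> ?g \<bullet> v" if "x \<in> P" for x
    using improving_neighbour_exists[OF P vP(1) that, of ?g] nb by (metis not_le)
  let ?F = "P \<inter> {x. ?g \<bullet> x = ?g \<bullet> v}"
  have F: "?F face_of P"
    using max P polytope_imp_convex by (intro face_of_Int_supporting_hyperplane_le) auto
  have pF: "polytope ?F" using P F face_of_polytope_polytope by blast
  have sub: "closed_segment v u \<subseteq> ?F"
    using vP uP gu pF polytope_imp_convex by (intro closed_segment_subset) auto
  \<comment> \<open>The edge is exposed inside \<open>?F\<close> by a functional \<open>b\<close>.
    If \<open>?F\<close> were larger, \<open>- b\<close> would improve from \<open>v\<close> towards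
    some point, hence along an edge of \<open>?F\<close> to a neighbour other than \<open>u\<close>.
    But \<open>u\<close> is the only neighbour of \<open>v\<close> that ties.\<close>
  have "closed_segment v u face_of ?F"
    using adj sub by (simp add: face_of_face[OF F] adjacent_vertices_def edge_of_def)
  then have "closed_segment v u exposed_face_of ?F"
    by (simp add: exposed_face_of_polyhedron polytope_imp_polyhedron[OF pF])
  then obtain b \<beta> where b: "?F \<subseteq> {x. b \<bullet> x \<le> \<beta>}" "closed_segment v u = ?F \<inter> {x. b \<bullet> x = \<beta>}"
    unfolding exposed_face_of_def by blast
  have bv: "b \<bullet> v = \<beta>" and bu: "b \<bullet> u = \<beta>"
    using b(2) ends_in_segment[of v u] by blast+
  show seg: "?F = closed_segment v u"
  proof (rule ccontr)
    assume "?F \<noteq> closed_segment v u"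
    then obtain z where z: "z \<in> ?F" "z \<notin> closed_segment v u" using sub by blast
    then have "b \<bullet> z < \<beta>" using b by force
    then have "(- b) \<bullet> v < (- b) \<bullet> z" using bv by simp
    moreover have "v extreme_point_of ?F" using vP by (simp add: extreme_point_of_face[OF F])
    ultimately obtain u' where u': "adjacent_vertices ?F v u'" "(- b) \<bullet> v < (- b) \<bullet> u'"
      using improving_neighbour_exists[OF pF] z by blast
    then have "u' = u" using nb adjacent_vertices_face[OF F u'(1)] by blast
    with u' bv bu show False by simp
  qed
  have "x = u \<or> c \<bullet> x < c \<bullet> u" if "x \<in> P" "?g \<bullet> x = ?g \<bullet> u" for x
  proof -
    have "x \<in> closed_segment v u" using seg that gu by auto
    then obtain l where l: "x = (1 - l) *\<^sub>R v + l *\<^sub>R u" "0 \<le> l" "l \<le> 1"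
      by (auto simp: closed_segment_def)
    show ?thesis
    proof (cases "l = 1")
      case False
      then have "0 < (1 - l) * (c \<bullet> u - c \<bullet> v)" using l cu by simp
      then show ?thesis unfolding l(1) by (simp add: inner_simps algebra_simps)
    qed (simp add: l(1))
  qed
  then show "upper_vertex P c w s u"
    using max uP gu by (auto simp: upper_vertex_def)
qed

section \<open>Increasing paths are determined by their point sets\<close>

lemma increasing_path_sorted:
  assumes "increasing_path P c a b xs"
  shows "sorted_wrt (\<lambda>x y. c \<bullet> x < c \<bullet> y) xs"
proof -
  have "successively (\<lambda>x y. c \<bullet> x < c \<bullet> y) xs"
    using assms by (auto simp: increasing_path_def elim: successively_mono)
  moreover have "transp (\<lambda>x y. c \<bullet> x < c \<bullet> y)" by (auto simp: transp_def)
  ultimately show ?thesis by (simp add: successively_conv_sorted_wrt)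
qed

text \<open>A path point outside the list is interior to a segment with ends in \<open>P\<close>, so
  it is not extreme. The vertices can thus be read off the point set.\<close>

lemma increasing_path_vertices:
  assumes path: "increasing_path P c a b xs"
  shows "set xs = {x \<in> path_points xs. x extreme_point_of P}"
proof
  show "set xs \<subseteq> {x \<in> path_points xs. x extreme_point_of P}"
    using path by (auto simp: increasing_path_def path_points_def)
  show "{x \<in> path_points xs. x extreme_point_of P} \<subseteq> set xs"
  proof
    fix x assume x: "x \<in> {x \<in> path_points xs. x extreme_point_of P}"
    show "x \<in> set xs"
    proof (rule ccontr)
      assume notin: "x \<notin> set xs"
      then obtain i where i: "i < length xs - 1" "x \<in> closed_segment (xs ! i) (xs ! Suc i)"
        using x by (auto simp: path_points_def)
      then have "xs ! i \<in> set xs" "xs ! Suc i \<in> set xs" by auto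
      then have "x \<in> open_segment (xs ! i) (xs ! Suc i)" "xs ! i \<in> P" "xs ! Suc i \<in> P"
        using i notin path
        by (auto simp: open_segment_def increasing_path_def extreme_point_of_def)
      with x show False by (auto simp: extreme_point_of_def)
    qed
  qed
qed

text \<open>The common point set fixes the set of vertices, and strict increase of \<open>c\<close>
  fixes their order and excludes repetitions.\<close>

lemma increasing_path_unique:
  assumes "increasing_path P c a b xs" "increasing_path P c a' b' ys"
    and "path_points xs = path_points ys"
  shows "xs = ys"
proof -
  have set: "set xs = set ys"
    using assms increasing_path_vertices by metis
  have sorted: "sorted_wrt (<) (map ((\<bullet>) c) zs)" if "increasing_path P c a b zs" for a b zs
    using increasing_path_sorted[OF that] by (simp add: sorted_wrt_map)
  have "map ((\<bullet>) c) xs = map ((\<bullet>) c) ys"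
    using sorted[OF assms(1)] sorted[OF assms(2)] set
    by (intro sorted_distinct_set_unique) (auto simp: strict_sorted_iff)
  moreover have "inj_on ((\<bullet>) c) (set xs \<union> set ys)"
    using sorted[OF assms(1)] set by (simp add: strict_sorted_iff distinct_map)
  ultimately show ?thesis by (rule map_inj_on)
qed

text \<open>A discrete intermediate value argument: at the least \<open>i\<close> with
  \<open>y\<close> at most \<open>f (Suc i)\<close>, the previous value is still at most
  \<open>y\<close>. Monotonicity is not assumed.\<close>

lemma sequence_crossing_index:
  fixes f :: "nat \<Rightarrow> real"
  assumes "f 0 \<le> y" "y \<le> f n" "0 < n"
  obtains i where "i < n" "f i \<le> y" "y \<le> f (Suc i)"
proof -
  define i where "i = (LEAST i. y \<le> f (Suc i))"
  have "y \<le> f (Suc (n - 1))" using assms by simp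
  then have i: "y \<le> f (Suc i)" "i \<le> n - 1"
    unfolding i_def by (auto intro: LeastI Least_le)
  have "f i \<le> y"
  proof (cases i)
    case (Suc j)
    then have "\<not> y \<le> f (Suc j)" using not_less_Least[of j "\<lambda>i. y \<le> f (Suc i)"] by (simp add: i_def)
    then show ?thesis using Suc by simp
  qed (use assms in simp)
  moreover have "i < n" using i(2) assms(3) by simp
  ultimately show thesis using that i(1) by blast
qed

section \<open>The max-slope walk and the shadow-vertex path\<close>

theorem proposition6p1:
  fixes P :: "(real^'n) set" and c w :: "real^'n" and r :: "nat \<Rightarrow> real^'n"
  assumes "polytope P" and "aff_dim P = int CARD('n)"
    and "generic_objective P c"
    and "generic_weight P c w"
    and "r 0 = opt_vertex P w"
    and "\<And>i. r (Suc i) = max_slope_arborescence P c w (r i)"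
  shows "\<exists>n. (\<forall>xs. shadow_vertex_path P c w xs \<longleftrightarrow> xs = map r [0..<Suc n]) \<and>
             (\<forall>i\<ge>n. r i = opt_vertex P c)"
proof -
  note P = assms(1) and gen = assms(3) and genw = assms(4)
  obtain r0 where r0: "maximizing_vertex P w r0" "\<And>v. maximizing_vertex P w v \<Longrightarrow> v = r0"
    using genw unfolding generic_weight_def by blast
  have r_0: "r 0 = r0" using opt_vertexI r0 assms(5) by metis
  have w_max: "w \<bullet> x < w \<bullet> r 0" if "x \<in> P" "x \<noteq> r 0" for x
    using maximizing_vertex_strict[OF P r0] that r_0 by blast
  have r0P: "r 0 extreme_point_of P" "r 0 \<in> P"
    using r0(1) r_0 by (auto simp: maximizing_vertex_def extreme_point_of_def)
  define vo where "vo = opt_vertex P c"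
  obtain v where v: "maximizing_vertex P c v"
    using maximizing_vertex_exists[OF P] r0P by blast
  then have "vo = v"
    unfolding vo_def
    by (intro opt_vertexI generic_objective_maximizing_vertex_unique[OF P gen])
  with v have vo: "maximizing_vertex P c vo" by simp
  have c_max: "c \<bullet> x < c \<bullet> vo" if "x \<in> P" "x \<noteq> vo" for x
    using maximizing_vertex_strict[OF P vo generic_objective_maximizing_vertex_unique[OF P gen vo]]
      that by blast
  have step: "max_slope_nb P c w (r i) (r (Suc i)) \<and>
      (\<forall>u. max_slope_nb P c w (r i) u \<longrightarrow> u = r (Suc i))"
    if "r i extreme_point_of P" "r i \<noteq> vo" for i
  proof -
    have ex1: "\<exists>!u. max_slope_nb P c w (r i) u"
      using genw that unfolding generic_weight_def vo_def by blast
    moreover have "r (Suc i) = (THE u. max_slope_nb P c w (r i) u)"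
      using that assms(6)[of i] by (simp add: max_slope_arborescence_def vo_def)
    ultimately show ?thesis by (metis theI')
  qed
  have stay: "r (Suc i) = vo" if "r i = vo" for i
    using that assms(6)[of i] by (simp add: max_slope_arborescence_def vo_def)
  have upper: "\<exists>t. upper_vertex P c w t (r i)" for i
  proof (induction i)
    case 0
    have "upper_vertex P c w 0 (r 0)"
      using w_max r0P by (force simp: upper_vertex_def less_le)
    then show ?case by blast
  next
    case (Suc i)
    then obtain t where t: "upper_vertex P c w t (r i)" by blast
    show ?case
    proof (cases "r i = vo")
      case True
      with t stay show ?thesis by metis
    next
      case False
      moreover have "r i extreme_point_of P" using t by (simp add: upper_vertex_def)
      ultimately show ?thesis using max_slope_edge(3)[OF P gen t] step by blast
    qed
  qed
  have ext: "r i extreme_point_of P" for i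
    using upper[of i] by (auto simp: upper_vertex_def)
  have rP: "r i \<in> P" for i using ext[of i] by (simp add: extreme_point_of_def)
  have adj: "adjacent_vertices P (r i) (r (Suc i)) \<and> c \<bullet> r i < c \<bullet> r (Suc i)"
    if "r i \<noteq> vo" for i
    using step[OF ext that] by (auto simp: max_slope_nb_def is_arg_max_def improving_nbs_def)
  have edge: "\<exists>s. (\<forall>x\<in>P. (w - s *\<^sub>R c) \<bullet> x \<le> (w - s *\<^sub>R c) \<bullet> r i) \<and>
      P \<inter> {x. (w - s *\<^sub>R c) \<bullet> x = (w - s *\<^sub>R c) \<bullet> r i} = closed_segment (r i) (r (Suc i))"
    if "r i \<noteq> vo" for i
  proof -
    obtain t where "upper_vertex P c w t (r i)" using upper by blast
    from max_slope_edge(1,2)[OF P gen this] step[OF ext that] show ?thesis by blast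
  qed
  \<comment> \<open>A walk that never reached \<open>vo\<close> would increase \<open>c\<close>
    forever and visit infinitely many vertices.\<close>
  have "\<exists>i. r i = vo"
  proof (rule ccontr)
    assume "\<nexists>i. r i = vo"
    then have "strict_mono (\<lambda>i. c \<bullet> r i)" using adj by (simp add: strict_mono_Suc_iff)
    then have "inj r" by (metis (no_types, lifting) injI strict_mono_eq)
    moreover have "finite (range r)"
      using finite_polyhedron_extreme_points[OF polytope_imp_polyhedron[OF P]] ext
      by (auto elim: rev_finite_subset)
    ultimately show False using finite_imageD infinite_UNIV_nat by blast
  qed
  \<comment> \<open>Stopping at the first visit to \<open>vo\<close> makes each step of the list a
    genuine edge, as strict increase demands. If \<open>r 0 = vo\<close>, the list is a single
    vertex.\<close>
  define n where "n = (LEAST i. r i = vo)"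
  have rn: "r n = vo" unfolding n_def using \<open>\<exists>i. r i = vo\<close> by (rule LeastI_ex)
  have before: "r i \<noteq> vo" if "i < n" for i
    using that not_less_Least unfolding n_def by blast
  have after: "r i = vo" if "n \<le> i" for i
    using that by (induction i rule: dec_induct) (auto simp: rn stay)
  have c_mono: "c \<bullet> r i \<le> c \<bullet> r j" if "i \<le> j" for i j
    using that
  proof (induction j rule: dec_induct)
    case (step j)
    have "c \<bullet> r j \<le> c \<bullet> r (Suc j)"
      using adj[of j] stay[of j] by (cases "r j = vo") auto
    with step show ?case by simp
  qed simp
  let ?p = "map r [0..<Suc n]"
  let ?X = "{x \<in> P. plane_proj c w x \<in> upper_path P c w}"
  have X: "x \<in> ?X \<longleftrightarrow> x \<in> P \<and> c \<bullet> r 0 \<le> c \<bullet> x \<and> c \<bullet> x \<le> c \<bullet> vo \<and>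
      (\<forall>y\<in>P. c \<bullet> y = c \<bullet> x \<longrightarrow> w \<bullet> y \<le> w \<bullet> x)" for x
    using assms(5) by (auto simp: upper_path_def upper_boundary_def plane_proj_def vo_def)
  have path: "increasing_path P c (opt_vertex P w) (opt_vertex P c) ?p"
  proof -
    have "successively (\<lambda>x y. adjacent_vertices P x y \<and> c \<bullet> x < c \<bullet> y) ?p"
      unfolding successively_conv_nth using adj before by (auto simp: nth_append simp del: upt_Suc)
    moreover have "hd ?p = r 0" "last ?p = r n" by (simp_all add: hd_map last_map del: upt_Suc)
    ultimately show ?thesis
      using rn ext assms(5) by (auto simp: increasing_path_def vo_def simp del: upt_Suc)
  qed
  have points: "path_points ?p = r ` {..n} \<union> (\<Union>i<n. closed_segment (r i) (r (Suc i)))"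
    by (auto simp: path_points_def simp del: upt_Suc)
  have seg_X: "closed_segment (r i) (r (Suc i)) \<subseteq> ?X" if "i < n" for i
  proof
    fix x assume x: "x \<in> closed_segment (r i) (r (Suc i))"
    obtain s where max: "\<And>y. y \<in> P \<Longrightarrow> (w - s *\<^sub>R c) \<bullet> y \<le> (w - s *\<^sub>R c) \<bullet> r i"
      and seg: "P \<inter> {x. (w - s *\<^sub>R c) \<bullet> x = (w - s *\<^sub>R c) \<bullet> r i} = closed_segment (r i) (r (Suc i))"
      using edge[OF before[OF \<open>i < n\<close>]] by blast
    have xP: "x \<in> P" and eq: "(w - s *\<^sub>R c) \<bullet> x = (w - s *\<^sub>R c) \<bullet> r i" using x seg by blast+
    have "closed_segment (r i) (r (Suc i)) \<subseteq> {x. c \<bullet> r 0 \<le> c \<bullet> x}"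
      using c_mono by (intro closed_segment_subset) (auto simp: convex_halfspace_ge)
    \<comment> \<open>Points with the same value of \<open>c\<close> are compared by
      \<open>w - s c\<close> exactly as by \<open>w\<close>, so a supporting line certifies the
      upper boundary.\<close>
    moreover have "w \<bullet> y \<le> w \<bullet> x" if "y \<in> P" "c \<bullet> y = c \<bullet> x" for y
      using max[OF that(1)] that eq by (simp add: inner_diff_left)
    ultimately show "x \<in> ?X"
      unfolding X using xP x c_max[of x] by fastforce
  qed
  have "path_points ?p = ?X"
  proof
    have "r i \<in> ?X" if "i \<le> n" for i
    proof (cases "i = n")
      \<comment> \<open>The endpoint may have no outgoing edge to rely on, but \<open>vo\<close> is
        the only point of \<open>P\<close> with its value of \<open>c\<close>.\<close>
      case True
      have "w \<bullet> y \<le> w \<bullet> vo" if "y \<in> P" "c \<bullet> y = c \<bullet> vo" for y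
        using c_max that by fastforce
      then show ?thesis unfolding X using True rP c_mono[of 0 i] rn by auto
    next
      case False
      with that show ?thesis using seg_X[of i] by auto
    qed
    then show "path_points ?p \<subseteq> ?X" unfolding points using seg_X by blast
  next
    show "?X \<subseteq> path_points ?p"
    proof
      fix x assume "x \<in> ?X"
      then have x: "x \<in> P" "c \<bullet> r 0 \<le> c \<bullet> x" "c \<bullet> x \<le> c \<bullet> vo"
        and x_up: "\<And>y. y \<in> P \<Longrightarrow> c \<bullet> y = c \<bullet> x \<Longrightarrow> w \<bullet> y \<le> w \<bullet> x" unfolding X by auto
      \<comment> \<open>For \<open>n = 0\<close> the range of \<open>c\<close> shrinks to its
        maximum, attained only at \<open>vo\<close>. Otherwise \<open>c\<close> at \<open>x\<close>
        falls within the range of some edge of the walk.\<close>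
      show "x \<in> path_points ?p"
      proof (cases "n = 0")
        case True
        then have "x = r n" using x rn c_max[of x] by force
        then show ?thesis unfolding points by simp
      next
        case False
        then obtain i where i: "i < n" "c \<bullet> r i \<le> c \<bullet> x" "c \<bullet> x \<le> c \<bullet> r (Suc i)"
          using sequence_crossing_index[of "\<lambda>i. c \<bullet> r i" "c \<bullet> x" n] x rn by auto
        obtain s where max: "\<And>y. y \<in> P \<Longrightarrow> (w - s *\<^sub>R c) \<bullet> y \<le> (w - s *\<^sub>R c) \<bullet> r i"
          and seg: "P \<inter> {x. (w - s *\<^sub>R c) \<bullet> x = (w - s *\<^sub>R c) \<bullet> r i} =
                      closed_segment (r i) (r (Suc i))"
          using edge[OF before[OF i(1)]] by blast
        \<comment> \<open>The point \<open>y\<close> of the edge lies over the same first coordinate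
          as \<open>x\<close>. As \<open>x\<close> is on the upper boundary, it is at least as high
          as \<open>y\<close>, so it also maximizes \<open>w - s c\<close> and lies in the full
          preimage, which is the edge.\<close>
        obtain y where y: "y \<in> closed_segment (r i) (r (Suc i))" "c \<bullet> y = c \<bullet> x"
          using connected_ivt_hyperplane[of "closed_segment (r i) (r (Suc i))" "r i" "r (Suc i)" c "c \<bullet> x"] i
          by auto
        then have yP: "y \<in> P" "(w - s *\<^sub>R c) \<bullet> y = (w - s *\<^sub>R c) \<bullet> r i" using seg by blast+
        have "(w - s *\<^sub>R c) \<bullet> x = (w - s *\<^sub>R c) \<bullet> r i"
          using x_up[OF yP(1) y(2)] yP(2) max[OF x(1)] y(2) by (simp add: inner_diff_left)
        then have "x \<in> closed_segment (r i) (r (Suc i))" using seg x by blast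
        with i show ?thesis unfolding points by blast
      qed
    qed
  qed
  with path have sp: "shadow_vertex_path P c w ?p" by (simp add: shadow_vertex_path_def del: upt_Suc)
  have "xs = ?p" if "shadow_vertex_path P c w xs" for xs
    using that sp increasing_path_unique unfolding shadow_vertex_path_def by metis
  with sp after show ?thesis unfolding vo_def by blast
qed

end
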